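(* We have $$A^{1\underline{23}}(x,q)=1+I^{1\underline{23}}(x,q)+\frac{x}{1-xq}\left[\left(A^{1\underline{23}}(x,q)-1\right)xq+x\right].$$ Also, $$I^{1\underline{23}}(x)=\frac{1-x-x^2}{1-x}B(x)-1,$$ where $B(x)=\sum_{n\ge0}B_nx^n$ and $B_n$ is the $n$-th Bell number (the number of set partitions of $[n]$). Moreover, $I^{1\underline{23}}_1=1$ and for $n\ge2$, $$I^{1\underline{23}}_n=B_n-\sum_{i=0}^{n-2}B_i.$$
   Context: For a permutation $\pi=\pi_1\cdots\pi_n$ of $[n]$, let $i_\pi$ be the smallest index $i$ with $\{\pi_1,\dots,\pi_i\}=\{1,\dots,i\}$; $\pi$ is indecomposable if $i_\pi=n$ (the empty permutation is not indecomposable). A permutation $\pi$ contains the vincular pattern $1\underline{23}$ if there are indices $j<k<n$ with $\pi_j<\pi_k<\pi_{k+1}$; otherwise it avoids it. A descent of $\pi$ is an index $i$ with $\pi_i>\pi_{i+1}$. For a pattern $\sigma$, $A^\sigma_{n,i}$ (resp. $I^\sigma_{n,i}$) is the number of $\sigma$-avoiding permutations (resp. $\sigma$-avoiding indecomposable permutations) of $[n]$ with $i$ descents; $A^\sigma(x,q)=1+\sum_{n\ge1}\sum_iA^\sigma_{n,i}x^nq^i$, $I^\sigma(x,q)=\sum_{n\ge1}\sum_iI^\sigma_{n,i}x^nq^i$, $I^\sigma(x)=I^\sigma(x,1)=\sum_{n\ge1}I^\sigma_nx^n$. *)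

theory Defs
  imports
    "HOL-Library.Disjoint_Sets"
    "HOL-Combinatorics.Multiset_Permutations"
    "HOL-Computational_Algebra.Formal_Power_Series"
begin

text \<open>
  A permutation of $[n]$ is given by its one-line notation, an element of
  \<^term>\<open>permutations_of_set {1..n::nat}\<close>. List positions start at 0, so the entry
  $\pi_j$ is \<^term>\<open>\<pi> ! (j - 1)\<close>; this shift affects none of the notions below.
\<close>

definition avoids_1_23 :: "nat list \<Rightarrow> bool" where
  "avoids_1_23 \<pi> \<longleftrightarrow>
     \<not> (\<exists>j k. j < k \<and> k + 1 < length \<pi> \<and> \<pi> ! j < \<pi> ! k \<and> \<pi> ! k < \<pi> ! (k + 1))"

definition descents :: "nat list \<Rightarrow> nat" where
  "descents \<pi> = card {i. i + 1 < length \<pi> \<and> \<pi> ! i > \<pi> ! (i + 1)}"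

definition first_component :: "nat list \<Rightarrow> nat" where
  "first_component \<pi> = (LEAST i. 1 \<le> i \<and> set (take i \<pi>) = {1..i})"

definition indecomposable :: "nat list \<Rightarrow> bool" where
  "indecomposable \<pi> \<longleftrightarrow> \<pi> \<noteq> [] \<and> first_component \<pi> = length \<pi>"

definition avoiders :: "nat \<Rightarrow> nat list set" where
  "avoiders n = {\<pi> \<in> permutations_of_set {1..n}. avoids_1_23 \<pi>}"

definition indec_avoiders :: "nat \<Rightarrow> nat list set" where
  "indec_avoiders n = {\<pi> \<in> avoiders n. indecomposable \<pi>}"

definition A_num :: "nat \<Rightarrow> nat \<Rightarrow> nat" where
  "A_num n i = card {\<pi> \<in> avoiders n. descents \<pi> = i}"

definition I_num :: "nat \<Rightarrow> nat \<Rightarrow> nat" where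
  "I_num n i = card {\<pi> \<in> indec_avoiders n. descents \<pi> = i}"

definition I_total :: "nat \<Rightarrow> nat" where
  "I_total n = card (indec_avoiders n)"

text \<open>
  The generating functions are power series in $x$, with $q$ in an arbitrary commutative ring:
  taking \<open>q = fps_X\<close> makes $q$ a formal variable, and \<open>q = 1\<close> is the specialisation
  $I(x) = I(x,1)$. A nonempty permutation of $[n]$ has fewer than $n$ descents, so the inner sums
  run over all relevant $i$.
\<close>

definition A_gf :: "'a::comm_ring_1 \<Rightarrow> 'a fps" where
  "A_gf q = 1 + Abs_fps (\<lambda>n. if n \<ge> 1 then (\<Sum>i<n. of_nat (A_num n i) * q ^ i) else 0)"

definition I_gf :: "'a::comm_ring_1 \<Rightarrow> 'a fps" where
  "I_gf q = Abs_fps (\<lambda>n. if n \<ge> 1 then (\<Sum>i<n. of_nat (I_num n i) * q ^ i) else 0)"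

definition Bell :: "nat \<Rightarrow> nat" where
  "Bell n = card {P. partition_on {1..n} P}"

definition Bell_gf :: "'a::comm_ring_1 fps" where
  "Bell_gf = Abs_fps (\<lambda>n. of_nat (Bell n))"

lemma descents_less_length: "\<pi> \<noteq> [] \<Longrightarrow> descents \<pi> < length \<pi>"
proof -
  assume "\<pi> \<noteq> []"
  have "descents \<pi> \<le> card {..<length \<pi> - 1}"
    unfolding descents_def by (rule card_mono) auto
  with \<open>\<pi> \<noteq> []\<close> show ?thesis by (cases \<pi>) auto
qed

lemma descents_less:
  assumes "1 \<le> n" "\<pi> \<in> permutations_of_set {1..n}"
  shows "descents \<pi> < n"
proof -
  have "length \<pi> = n"
    using length_finite_permutations_of_set[OF assms(2)] by simp
  then show ?thesis using assms(1) descents_less_length[of \<pi>] by fastforce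
qed

lemma I_total_eq_sum:
  assumes "1 \<le> n"
  shows "I_total n = (\<Sum>i<n. I_num n i)"
proof -
  have fin: "finite (indec_avoiders n)"
    by (auto simp: indec_avoiders_def avoiders_def)
  have "descents \<pi> < n" if "\<pi> \<in> indec_avoiders n" for \<pi>
    using that assms descents_less[of n \<pi>] by (auto simp: indec_avoiders_def avoiders_def)
  then have "descents ` indec_avoiders n \<subseteq> {..<n}" by auto
  then have "(\<Sum>i<n. \<Sum>\<pi> \<in> {\<pi> \<in> indec_avoiders n. descents \<pi> = i}. 1)
      = (\<Sum>\<pi> \<in> indec_avoiders n. 1::nat)"
    using fin by (intro sum.group) auto
  then show ?thesis by (simp add: I_total_def I_num_def)
qed

lemma I_gf_1_nth: "n \<ge> 1 \<Longrightarrow> fps_nth (I_gf (1::'a::comm_ring_1)) n = of_nat (I_total n)"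
  by (simp add: I_gf_def I_total_eq_sum)

text \<open>
  Over the coefficient ring \<^typ>\<open>rat fps\<close>, which is not a field, division by $1 - xq$ is still
  multiplication by its inverse, because its constant term is 1.
\<close>

lemma divide_one_minus_xq:
  fixes f :: "rat fps fps" and q :: "rat fps"
  shows "f / (1 - fps_X * fps_const q) * (1 - fps_X * fps_const q) = f"
proof -
  let ?g = "1 - fps_X * fps_const q :: rat fps fps"
  have g0: "fps_nth ?g 0 = 1" by simp
  then have sd: "subdegree ?g = 0" by (intro subdegree_eq_0) simp
  have i1: "inverse (1 :: rat fps) = 1" by (rule fps_inverse_one') simp
  have "?g * fps_right_inverse ?g 1 = 1"
    by (rule fps_right_inverse) (simp add: g0)
  then have "?g * inverse ?g = 1"
    by (simp only: fps_inverse_def[of ?g] g0 i1)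
  then show ?thesis by (simp add: fps_divide_unit'[OF sd] mult.assoc mult.commute[of ?g])
qed

end

theory Submission
  imports Defs
begin

text \<open>
  Write a permutation as \<open>\<sigma> @ m # \<tau>\<close> with \<open>m\<close> its minimum. It avoids the pattern iff \<open>\<sigma>\<close> does and
  \<open>\<tau>\<close> is decreasing, so an avoider on \<open>S\<close> is a subset \<open>T\<close> of \<open>S - {m}\<close> together with an avoider
  on \<open>T\<close>. Set partitions obey the same recursion (\<open>S - T\<close> being the block of \<open>m\<close>), whence the Bell
  numbers. The avoider is decomposable iff \<open>T = {2..k+1}\<close> for some \<open>k < n - 1\<close>; the nonempty
  decreasing tail then contributes the factor \<open>x / (1 - xq)\<close>, and \<open>\<sigma> @ [1]\<close> contributes \<open>x\<close> if \<open>\<sigma>\<close>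
  is empty and otherwise \<open>xq\<close> times the weight of \<open>\<sigma>\<close>.
\<close>

section \<open>Splitting an avoider at its minimum\<close>

text \<open>Entry sets are arbitrary because the part to the left of the minimum uses an arbitrary
  subset of the letters; no standardisation is then required.\<close>

definition avoiders_on :: "nat set \<Rightarrow> nat list set" where
  "avoiders_on S = {\<pi> \<in> permutations_of_set S. avoids_1_23 \<pi>}"

lemma avoiders_eq_avoiders_on: "avoiders n = avoiders_on {1..n}"
  by (simp add: avoiders_def avoiders_on_def)

lemma finite_avoiders_on [simp]: "finite (avoiders_on S)"
  by (simp add: avoiders_on_def)

lemma avoiders_on_iff:
  "\<pi> \<in> avoiders_on S \<longleftrightarrow> set \<pi> = S \<and> distinct \<pi> \<and> avoids_1_23 \<pi>"
  by (auto simp: avoiders_on_def permutations_of_set_def)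

lemma avoids_Nil [simp]: "avoids_1_23 []"
  by (simp add: avoids_1_23_def)

lemma avoiders_on_empty [simp]: "avoiders_on {} = {[]}"
  by (auto simp: avoiders_on_iff)

text \<open>Every ascent in \<open>\<tau>\<close> completes an occurrence that starts at
  \<open>m\<close>. Conversely, an occurrence cannot have its adjacent pair touch \<open>m\<close>:
  the step into \<open>m\<close> is a descent, and no earlier entry lies below
  \<open>m\<close>.\<close>

lemma avoids_append_min_iff:
  assumes \<sigma>: "\<And>x. x \<in> set \<sigma> \<Longrightarrow> m < x" and \<tau>: "\<And>x. x \<in> set \<tau> \<Longrightarrow> m < x"
  shows "avoids_1_23 (\<sigma> @ m # \<tau>) \<longleftrightarrow> avoids_1_23 \<sigma> \<and> sorted (rev \<tau>)"
proof
  let ?\<pi> = "\<sigma> @ m # \<tau>"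
  assume av: "avoids_1_23 ?\<pi>"
  have "avoids_1_23 \<sigma>"
    unfolding avoids_1_23_def
  proof (intro notI, elim exE conjE)
    fix j k assume "j < k" "k + 1 < length \<sigma>" "\<sigma> ! j < \<sigma> ! k" "\<sigma> ! k < \<sigma> ! (k + 1)"
    then have "j < k \<and> k + 1 < length ?\<pi> \<and> ?\<pi> ! j < ?\<pi> ! k \<and> ?\<pi> ! k < ?\<pi> ! (k + 1)"
      by (auto simp: nth_append)
    with av show False unfolding avoids_1_23_def by blast
  qed
  moreover have "\<tau> ! Suc i \<le> \<tau> ! i" if "Suc i < length \<tau>" for i
  proof (rule ccontr)
    assume "\<not> \<tau> ! Suc i \<le> \<tau> ! i"
    moreover have "m < \<tau> ! i" using that \<tau> by simp
    \<comment> \<open>The occurrence uses \<open>m\<close>, at position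
      \<open>length \<sigma>\<close>, and the entries of \<open>\<tau>\<close> at \<open>i\<close>
      and \<open>i + 1\<close>, shifted by \<open>length \<sigma> + 1\<close>.\<close>
    ultimately have "length \<sigma> < length \<sigma> + Suc i \<and> length \<sigma> + Suc i + 1 < length ?\<pi> \<and>
        ?\<pi> ! length \<sigma> < ?\<pi> ! (length \<sigma> + Suc i) \<and>
        ?\<pi> ! (length \<sigma> + Suc i) < ?\<pi> ! (length \<sigma> + Suc i + 1)"
      using that by (auto simp: nth_append)
    with av show False unfolding avoids_1_23_def by blast
  qed
  ultimately show "avoids_1_23 \<sigma> \<and> sorted (rev \<tau>)"
    by (simp add: sorted_rev_iff_nth_Suc)
next
  let ?\<pi> = "\<sigma> @ m # \<tau>"
  assume R: "avoids_1_23 \<sigma> \<and> sorted (rev \<tau>)"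
  show "avoids_1_23 ?\<pi>"
    unfolding avoids_1_23_def
  proof (intro notI, elim exE conjE)
    fix j k assume jk: "j < k" "k + 1 < length ?\<pi>" "?\<pi> ! j < ?\<pi> ! k" "?\<pi> ! k < ?\<pi> ! (k + 1)"
    \<comment> \<open>The adjacent pair lies in \<open>\<sigma>\<close>, ends at \<open>m\<close>,
      starts at \<open>m\<close>, or lies in \<open>\<tau>\<close>.\<close>
    consider "k + 1 < length \<sigma>" | "k + 1 = length \<sigma>" | "k = length \<sigma>" | "length \<sigma> < k"
      by linarith
    then show False
    proof cases
      case 1
      then have "\<sigma> ! j < \<sigma> ! k" "\<sigma> ! k < \<sigma> ! (k + 1)" using jk by (auto simp: nth_append)
      with 1 jk(1) R show ?thesis unfolding avoids_1_23_def by blast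
    next
      case 2
      then have "m < ?\<pi> ! k" using \<sigma>[of "\<sigma> ! k"] by (simp add: nth_append)
      then show ?thesis using jk 2 by (auto simp: nth_append)
    next
      case 3
      then have "m < ?\<pi> ! j" using \<sigma>[of "\<sigma> ! j"] jk by (simp add: nth_append)
      then show ?thesis using jk 3 by (auto simp: nth_append)
    next
      case 4
      then obtain i where "k = length \<sigma> + Suc i" using less_iff_Suc_add by auto
      then show ?thesis using jk R by (auto simp: nth_append sorted_rev_iff_nth_Suc leD)
    qed
  qed
qed

text \<open>The only freedom is the set \<open>T\<close> of letters before \<open>m\<close> and
  their arrangement: the remaining letters must follow \<open>m\<close> in decreasing order.\<close>

lemma bij_betw_avoiders_insert_min:
  assumes S: "finite S" "\<And>x. x \<in> S \<Longrightarrow> m < x"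
  shows "bij_betw (\<lambda>(T, \<sigma>). \<sigma> @ m # rev (sorted_list_of_set (S - T)))
           (SIGMA T:Pow S. avoiders_on T) (avoiders_on (insert m S))"
proof (intro bij_betw_imageI)
  have mS: "m \<notin> S" using S(2) by blast
  show "inj_on (\<lambda>(T, \<sigma>). \<sigma> @ m # rev (sorted_list_of_set (S - T)))
          (SIGMA T:Pow S. avoiders_on T)"
  proof (rule inj_onI, clarsimp)
    fix T \<sigma> T' \<sigma>'
    assume T: "T \<subseteq> S" "\<sigma> \<in> avoiders_on T" "T' \<subseteq> S" "\<sigma>' \<in> avoiders_on T'"
      and eq: "\<sigma> @ m # rev (sorted_list_of_set (S - T)) =
               \<sigma>' @ m # rev (sorted_list_of_set (S - T'))"
    then have "m \<notin> set \<sigma>" "m \<notin> set \<sigma>'" using mS by (auto simp: avoiders_on_iff)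
    moreover have "m \<notin> set (rev (sorted_list_of_set (S - T)))" using mS S(1) by simp
    \<comment> \<open>\<open>m\<close> occurs exactly once, so the word splits around it in one way
      only.\<close>
    ultimately have "\<sigma> = \<sigma>'" using eq by (simp add: append_Cons_eq_iff)
    then show "T = T' \<and> \<sigma> = \<sigma>'" using T by (simp add: avoiders_on_iff)
  qed
  show "(\<lambda>(T, \<sigma>). \<sigma> @ m # rev (sorted_list_of_set (S - T))) `
          (SIGMA T:Pow S. avoiders_on T) = avoiders_on (insert m S)"
  proof (intro equalityI subsetI)
    fix \<pi> assume "\<pi> \<in> (\<lambda>(T, \<sigma>). \<sigma> @ m # rev (sorted_list_of_set (S - T))) `
          (SIGMA T:Pow S. avoiders_on T)"
    then obtain T \<sigma> where T: "T \<subseteq> S" "\<sigma> \<in> avoiders_on T"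
      and \<pi>: "\<pi> = \<sigma> @ m # rev (sorted_list_of_set (S - T))" by auto
    have "avoids_1_23 \<pi>"
      unfolding \<pi> using T S
      by (subst avoids_append_min_iff) (auto simp: avoiders_on_iff)
    then show "\<pi> \<in> avoiders_on (insert m S)"
      using T S mS by (auto simp: avoiders_on_iff \<pi>)
  next
    fix \<pi> assume \<pi>: "\<pi> \<in> avoiders_on (insert m S)"
    then have "m \<in> set \<pi>" by (simp add: avoiders_on_iff)
    then obtain \<sigma> \<tau> where st: "\<pi> = \<sigma> @ m # \<tau>" by (meson split_list)
    with \<pi> have d: "distinct \<sigma>" "distinct \<tau>" "set \<sigma> \<inter> set \<tau> = {}" "m \<notin> set \<sigma>" "m \<notin> set \<tau>"
      and s: "insert m (set \<sigma> \<union> set \<tau>) = insert m S" by (auto simp: avoiders_on_iff)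
    have S': "set \<sigma> \<union> set \<tau> = S" using d s mS by (metis Un_iff insert_ident)
    have "avoids_1_23 \<sigma> \<and> sorted (rev \<tau>)"
      using \<pi> S(2) S' unfolding st avoiders_on_iff
      by (subst avoids_append_min_iff[symmetric, of _ m]) auto
    moreover have "S - set \<sigma> = set (rev \<tau>)" using d S' by auto
    \<comment> \<open>A sorted list without repetitions is determined by its set.\<close>
    ultimately have "sorted_list_of_set (S - set \<sigma>) = rev \<tau>"
      using d by (metis distinct_rev sorted_list_of_set.idem_if_sorted_distinct)
    then show "\<pi> \<in> (\<lambda>(T, \<sigma>). \<sigma> @ m # rev (sorted_list_of_set (S - T))) `
          (SIGMA T:Pow S. avoiders_on T)"
      using st S' d \<open>avoids_1_23 \<sigma> \<and> sorted (rev \<tau>)\<close>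
      by (intro image_eqI[of _ _ "(set \<sigma>, \<sigma>)"]) (auto simp: avoiders_on_iff)
  qed
qed

section \<open>Avoiders and set partitions\<close>

text \<open>Removing the block of \<open>m\<close> leaves a partition of the elements outside it;
  this is the counterpart of splitting an avoider at its minimum, over the same index set
  \<open>Pow S\<close>.\<close>

lemma bij_betw_partitions_insert:
  assumes m: "m \<notin> S"
  shows "bij_betw (\<lambda>(T, Q). insert (insert m (S - T)) Q)
           (SIGMA T:Pow S. {Q. partition_on T Q}) {P. partition_on (insert m S) P}"
proof (intro bij_betw_imageI)
  show "inj_on (\<lambda>(T, Q). insert (insert m (S - T)) Q) (SIGMA T:Pow S. {Q. partition_on T Q})"
  proof (rule inj_onI, clarsimp)
    fix T Q T' Q'
    assume T: "T \<subseteq> S" "partition_on T Q" "T' \<subseteq> S" "partition_on T' Q'"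
      and eq: "insert (insert m (S - T)) Q = insert (insert m (S - T')) Q'"
    have Q: "m \<notin> X" if "X \<in> Q" for X using that T m by (auto simp: partition_on_def)
    have Q': "m \<notin> X" if "X \<in> Q'" for X using that T m by (auto simp: partition_on_def)
    \<comment> \<open>\<open>Q\<close> is recovered as the blocks that miss \<open>m\<close>, and
      then \<open>T\<close> as their union.\<close>
    have "Q = {X \<in> insert (insert m (S - T)) Q. m \<notin> X}" using Q by auto
    also have "\<dots> = Q'" unfolding eq using Q' by auto
    finally have "Q = Q'" .
    with T show "T = T' \<and> Q = Q'" by (auto simp: partition_on_def)
  qed
  show "(\<lambda>(T, Q). insert (insert m (S - T)) Q) ` (SIGMA T:Pow S. {Q. partition_on T Q})
          = {P. partition_on (insert m S) P}"
  proof (intro equalityI subsetI)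
    fix P assume "P \<in> (\<lambda>(T, Q). insert (insert m (S - T)) Q) `
      (SIGMA T:Pow S. {Q. partition_on T Q})"
    then obtain T Q where T: "T \<subseteq> S" "partition_on T Q" and P: "P = insert (insert m (S - T)) Q"
      by auto
    have "disjoint P"
      using T m unfolding P partition_on_def by (auto simp: disjoint_def)
    moreover have "\<Union>P = insert m S" "{} \<notin> P" using T unfolding P partition_on_def by auto
    ultimately show "P \<in> {P. partition_on (insert m S) P}" by (simp add: partition_on_def)
  next
    fix P assume "P \<in> {P. partition_on (insert m S) P}"
    then have P: "\<Union>P = insert m S" "disjoint P" "{} \<notin> P" by (auto simp: partition_on_def)
    then obtain X where X: "X \<in> P" "m \<in> X" by blast
    define T where "T = S - X"
    have "disjoint (P - {X})" using P(2) by (auto simp: disjoint_def)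
    moreover have "\<Union>(P - {X}) = T"
    proof -
      have "Y \<inter> X = {}" if "Y \<in> P - {X}" for Y using that P(2) X(1) by (auto dest: disjointD)
      then have "\<Union>(P - {X}) = \<Union>P - X" by blast
      also have "\<dots> = T" unfolding P(1) T_def using X(2) by blast
      finally show ?thesis .
    qed
    ultimately have "partition_on T (P - {X})" using P by (simp add: partition_on_def)
    moreover have "insert m (S - T) = X" using X P by (auto simp: T_def)
    ultimately show "P \<in> (\<lambda>(T, Q). insert (insert m (S - T)) Q) `
      (SIGMA T:Pow S. {Q. partition_on T Q})"
      using X by (intro image_eqI[of _ _ "(T, P - {X})"]) (auto simp: T_def)
  qed
qed

text \<open>Both counts are sums over the subsets \<open>T\<close> of \<open>S\<close> without its
  minimum. Since \<open>T\<close> can be any of these, the induction runs over all proper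
  subsets.\<close>

lemma card_avoiders_on:
  "finite S \<Longrightarrow> card (avoiders_on S) = card {P. partition_on S P}"
proof (induction S rule: finite_psubset_induct)
  case (psubset S)
  show ?case
  proof (cases "S = {}")
    case True
    then show ?thesis by (simp add: partition_on_empty)
  next
    case False
    define m where "m = Min S"
    define S' where "S' = S - {m}"
    have "m \<in> S" unfolding m_def using False psubset.hyps by (intro Min_in)
    then have S: "S = insert m S'" and fin: "finite S'"
      using psubset.hyps by (auto simp: S'_def)
    have less: "m < x" if "x \<in> S'" for x
      using that psubset.hyps by (auto simp: m_def S'_def le_neq_implies_less)
    have IH: "card (avoiders_on T) = card {P. partition_on T P}" if "T \<subseteq> S'" for T
      using that less by (intro psubset.IH) (auto simp: S)
    have "card (avoiders_on S) = card (SIGMA T:Pow S'. avoiders_on T)"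
      unfolding S using bij_betw_same_card[OF bij_betw_avoiders_insert_min[OF fin less]] by simp
    also have "\<dots> = (\<Sum>T\<in>Pow S'. card (avoiders_on T))"
      by (rule card_SigmaI) (use fin in auto)
    also have "\<dots> = (\<Sum>T\<in>Pow S'. card {P. partition_on T P})"
      using IH by (intro sum.cong) auto
    also have "\<dots> = card (SIGMA T:Pow S'. {P. partition_on T P})"
      by (rule card_SigmaI[symmetric])
        (use fin in \<open>auto intro!: finitely_many_partition_on intro: finite_subset\<close>)
    also have "\<dots> = card {P. partition_on S P}"
      unfolding S using less by (intro bij_betw_same_card[OF bij_betw_partitions_insert]) blast
    finally show ?thesis .
  qed
qed

lemma card_avoiders: "card (avoiders n) = Bell n"
  by (simp add: avoiders_eq_avoiders_on Bell_def card_avoiders_on)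

section \<open>Decomposable avoiders\<close>

lemma descents_Nil [simp]: "descents [] = 0"
  by (simp add: descents_def)

text \<open>The descent set is that of the tail shifted by one, plus possibly position 0.\<close>

lemma descents_Cons_Cons:
  "descents (x # y # zs) = (if x > y then 1 else 0) + descents (y # zs)"
proof -
  let ?D = "\<lambda>\<pi>. {i. i + 1 < length \<pi> \<and> \<pi> ! i > \<pi> ! (i + 1)}"
  have "?D (x # y # zs) = (if x > y then {0} else {}) \<union> Suc ` ?D (y # zs)" (is "?L = ?R")
  proof (rule set_eqI)
    show "i \<in> ?L \<longleftrightarrow> i \<in> ?R" for i by (cases i) auto
  qed
  moreover have "finite (?D (y # zs))" by simp
  ultimately show ?thesis
    unfolding descents_def by (subst card_Un_disjoint[symmetric] | simp add: card_image)+
qed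

lemma descents_single [simp]: "descents [x] = 0"
  by (simp add: descents_def)

text \<open>The \<open>Suc\<close> is the descent from the last entry of \<open>\<sigma>\<close>
  into \<open>m\<close>, which exists only if \<open>\<sigma>\<close> is nonempty.\<close>

lemma descents_append_min:
  "(\<And>x. x \<in> set \<sigma> \<Longrightarrow> m < x) \<Longrightarrow>
   descents (\<sigma> @ m # \<tau>) = (if \<sigma> = [] then 0 else Suc (descents \<sigma>)) + descents (m # \<tau>)"
proof (induction \<sigma>)
  case (Cons a \<sigma>)
  then show ?case by (cases \<sigma>) (auto simp: descents_Cons_Cons)
qed simp

lemma descents_decreasing: "sorted (rev \<tau>) \<Longrightarrow> distinct \<tau> \<Longrightarrow> descents \<tau> = length \<tau> - 1"
proof (induction \<tau>)
  case (Cons a \<tau>)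
  then show ?case by (cases \<tau>) (auto simp: descents_Cons_Cons sorted_append)
qed simp

lemma descents_map_Suc [simp]: "descents (map Suc \<pi>) = descents \<pi>"
  unfolding descents_def by (rule arg_cong[where f = card]) auto

lemma avoids_map_Suc [simp]: "avoids_1_23 (map Suc \<pi>) \<longleftrightarrow> avoids_1_23 \<pi>"
  unfolding avoids_1_23_def by (intro arg_cong[where f = Not] iff_exI) auto

text \<open>Brings the left parts of decomposable avoiders back to an initial interval, so that they
  are counted by coefficients of \<open>A_gf\<close>.\<close>

lemma bij_betw_map_Suc_avoiders:
  "bij_betw (map Suc) (avoiders k) (avoiders_on {2..Suc k})"
proof (intro bij_betw_imageI)
  show "map Suc ` avoiders k = avoiders_on {2..Suc k}"
  proof (intro equalityI subsetI)
    fix \<pi> assume "\<pi> \<in> map Suc ` avoiders k"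
    then show "\<pi> \<in> avoiders_on {2..Suc k}"
      by (auto simp: avoiders_eq_avoiders_on avoiders_on_iff distinct_map numeral_2_eq_2
          image_Suc_atLeastAtMost[symmetric] simp del: image_Suc_atLeastAtMost)
  next
    fix \<pi> assume \<pi>: "\<pi> \<in> avoiders_on {2..Suc k}"
    \<comment> \<open>All entries are at least 2, so the truncated subtraction does invert
      \<open>Suc\<close>.\<close>
    define \<sigma> where "\<sigma> = map (\<lambda>x. x - 1) \<pi>"
    have eq: "\<pi> = map Suc \<sigma>"
      using \<pi> by (auto simp: \<sigma>_def avoiders_on_iff intro!: map_idI[symmetric])
    have "Suc ` set \<sigma> = Suc ` {1..k}"
      using \<pi> unfolding eq by (simp add: avoiders_on_iff numeral_2_eq_2)
    then have "set \<sigma> = {1..k}" by (simp only: inj_image_eq_iff[OF inj_Suc])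
    then show "\<pi> \<in> map Suc ` avoiders k"
      using \<pi> unfolding eq by (auto simp: avoiders_eq_avoiders_on avoiders_on_iff distinct_map)
  qed
qed (simp add: inj_on_def)

text \<open>The whole word always satisfies the prefix condition, so the \<open>LEAST\<close> is
  well defined and equals \<open>n\<close> unless a shorter prefix qualifies.\<close>

lemma indecomposable_iff:
  assumes "\<pi> \<in> permutations_of_set {1..n}" "n \<ge> 1"
  shows "indecomposable \<pi> \<longleftrightarrow> (\<forall>i. 1 \<le> i \<longrightarrow> i < n \<longrightarrow> set (take i \<pi>) \<noteq> {1..i})"
proof -
  let ?P = "\<lambda>i. 1 \<le> i \<and> set (take i \<pi>) = {1..i}"
  have len: "length \<pi> = n" and s: "set \<pi> = {1..n}"
    using assms length_finite_permutations_of_set[of \<pi> "{1..n}"]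
    by (auto simp: permutations_of_set_def)
  then have P: "?P n" using assms by simp
  have "(LEAST i. ?P i) = n \<longleftrightarrow> (\<forall>i<n. \<not> ?P i)"
    using P by (metis (mono_tags, lifting) LeastI Least_le le_antisym not_less not_less_Least)
  moreover have "\<pi> \<noteq> []" using len assms by auto
  ultimately show ?thesis by (auto simp: indecomposable_def first_component_def len)
qed

text \<open>In \<open>\<sigma> @ 1 # \<tau>\<close> with \<open>\<tau>\<close> decreasing, a proper prefix \<open>{1..i}\<close> must contain \<open>1\<close> but miss
  the largest entry \<open>n\<close>, which comes first in \<open>\<tau>\<close>; hence the prefix is exactly \<open>\<sigma> @ [1]\<close>.\<close>

lemma not_indecomposable_append_min_iff:
  assumes "n \<ge> 1" "T \<subseteq> {2..n}" "\<sigma> \<in> avoiders_on T"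
  shows "\<not> indecomposable (\<sigma> @ 1 # rev (sorted_list_of_set ({2..n} - T))) \<longleftrightarrow>
           (\<exists>k<n - 1. T = {2..Suc k})"
proof -
  let ?\<tau> = "rev (sorted_list_of_set ({2..n} - T))"
  let ?\<pi> = "\<sigma> @ 1 # ?\<tau>"
  have \<sigma>: "set \<sigma> = T" "distinct \<sigma>" using assms(3) by (simp_all add: avoiders_on_iff)
  have perm: "?\<pi> \<in> permutations_of_set {1..n}"
  proof
    have "set ?\<pi> = insert 1 (T \<union> ({2..n} - T))" by (simp add: \<sigma>)
    also have "\<dots> = {1..n}" using assms(1,2) by auto
    finally show "set ?\<pi> = {1..n}" .
    show "distinct ?\<pi>" using assms(2) \<sigma> by auto
  qed
  have dec: "\<not> indecomposable ?\<pi> \<longleftrightarrow> (\<exists>i. 1 \<le> i \<and> i < n \<and> set (take i ?\<pi>) = {1..i})"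
    using indecomposable_iff[OF perm assms(1)] by auto
  show ?thesis
  proof
    assume "\<not> indecomposable ?\<pi>"
    then obtain i where i: "1 \<le> i" "i < n" "set (take i ?\<pi>) = {1..i}" using dec by blast
    have "1 \<in> set (take i ?\<pi>)" using i by simp
    moreover have "1 \<notin> set \<sigma>" using \<sigma> assms by auto
    \<comment> \<open>A prefix ending inside \<open>\<sigma>\<close> would miss the entry 1.\<close>
    ultimately have li: "length \<sigma> < i"
      by (metis in_set_takeD not_less take_all_iff take_append append_Nil2 diff_is_0_eq take_0)
    then have tk: "take i ?\<pi> = \<sigma> @ 1 # take (i - Suc (length \<sigma>)) ?\<tau>"
      by (simp add: take_Cons')
    have "T \<subseteq> {1..i}" using i(3) \<sigma> unfolding tk by auto
    then have n: "n \<in> {2..n} - T" using i by auto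
    then have ne: "?\<tau> \<noteq> []" by auto
    have "x \<le> hd ?\<tau>" if "x \<in> set ?\<tau>" for x
    proof -
      have "sorted (rev ?\<tau>)" by simp
      then show ?thesis using that ne by (cases ?\<tau>) (auto simp: sorted_append)
    qed
    then have "n \<le> hd ?\<tau>" using n by simp
    then have hd: "hd ?\<tau> \<notin> {1..i}" using i by simp
    have "i = Suc (length \<sigma>)"
    proof (rule ccontr)
      assume "i \<noteq> Suc (length \<sigma>)"
      then have "hd ?\<tau> \<in> set (take (i - Suc (length \<sigma>)) ?\<tau>)"
        using li ne by (cases ?\<tau>) (auto simp: take_Cons')
      then have "hd ?\<tau> \<in> {1..i}" using i(3) unfolding tk by (metis Un_iff list.set_intros(2) set_append)
      with hd show False by blast
    qed
    then have "insert 1 T = {1..i}" using i(3) \<sigma> unfolding tk by auto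
    then have "T = {1..i} - {1}" using \<open>1 \<notin> set \<sigma>\<close> unfolding \<sigma>(1) by blast
    \<comment> \<open>The witness is \<open>k = i - 1\<close>, as the prefix of length
      \<open>i\<close> also counts the entry 1.\<close>
    also have "\<dots> = {2..Suc (i - 1)}" using i(1) by auto
    finally show "\<exists>k<n - 1. T = {2..Suc k}" using i(1,2) by (intro exI[of _ "i - 1"]) auto
  next
    assume "\<exists>k<n - 1. T = {2..Suc k}"
    then obtain k where k: "k < n - 1" "T = {2..Suc k}" by blast
    \<comment> \<open>Hence the prefix of length \<open>k + 1\<close> stops exactly after the entry
      1.\<close>
    have "length \<sigma> = k" using distinct_card[OF \<sigma>(2)] unfolding \<sigma>(1) k(2) by simp
    then have "set (take (Suc k) ?\<pi>) = insert 1 {2..Suc k}" by (simp add: \<sigma>(1) k(2))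
    also have "\<dots> = {1..Suc k}" by auto
    finally have "set (take (Suc k) ?\<pi>) = {1..Suc k}" .
    then show "\<not> indecomposable ?\<pi>" using k(1) unfolding dec by (intro exI[of _ "Suc k"]) auto
  qed
qed

text \<open>For \<open>k < n - 1\<close> and an avoider \<open>\<sigma>\<close> of size
  \<open>k\<close>, the first component is \<open>map Suc \<sigma> @ [1]\<close>. The set difference
  keeps the shape of the general bijection at the minimum with
  \<open>T = {2..Suc k}\<close>.\<close>

definition glue :: "nat \<Rightarrow> nat \<Rightarrow> nat list \<Rightarrow> nat list" where
  "glue n k \<sigma> = map Suc \<sigma> @ 1 # rev (sorted_list_of_set ({2..n} - {2..Suc k}))"

text \<open>This is the bijection at the minimum restricted to the sets
  \<open>T = {2..Suc k}\<close>; the bound on \<open>k\<close> keeps the tail nonempty.\<close>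

lemma bij_betw_glue:
  assumes "n \<ge> 1"
  shows "bij_betw (\<lambda>(k, \<sigma>). glue n k \<sigma>) (SIGMA k:{..<n - 1}. avoiders k)
           (avoiders n - indec_avoiders n)"
proof -
  let ?f = "\<lambda>(T, \<sigma>). \<sigma> @ 1 # rev (sorted_list_of_set ({2..n} - T))"
  let ?g = "\<lambda>(k, \<sigma>). ({2..Suc k}, map Suc \<sigma>)"
  let ?A = "SIGMA k:{..<n - 1}. avoiders k"
  have f: "bij_betw ?f (SIGMA T:Pow {2..n}. avoiders_on T) (avoiders n)"
  proof -
    have "insert 1 {2..n} = {1..n}" using assms by auto
    then show ?thesis
      using bij_betw_avoiders_insert_min[of "{2..n}" 1] by (simp add: avoiders_eq_avoiders_on)
  qed
  have map: "map Suc ` avoiders k = avoiders_on {2..Suc k}" for k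
    using bij_betw_map_Suc_avoiders by (simp add: bij_betw_def)
  \<comment> \<open>\<open>?G\<close> consists of the pairs that \<open>?f\<close> sends to
    decomposable avoiders, and \<open>?g\<close> parametrises it.\<close>
  have gA: "?g ` ?A = {(T, \<sigma>) \<in> (SIGMA T:Pow {2..n}. avoiders_on T).
               \<exists>k<n - 1. T = {2..Suc k}}" (is "_ = ?G")
  proof (intro equalityI subsetI)
    fix p assume "p \<in> ?G"
    then obtain k \<sigma> where k: "k < n - 1" "p = ({2..Suc k}, \<sigma>)" "\<sigma> \<in> avoiders_on {2..Suc k}" by auto
    then obtain \<sigma>' where "\<sigma>' \<in> avoiders k" "\<sigma> = map Suc \<sigma>'" unfolding map[symmetric] by auto
    with k show "p \<in> ?g ` ?A" by (intro image_eqI[of _ _ "(k, \<sigma>')"]) auto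
  qed (use map in auto)
  \<comment> \<open>\<open>k = 0\<close> is the only value giving the empty interval, so
    \<open>{2..Suc k}\<close> determines \<open>k\<close>.\<close>
  have "inj_on ?g ?A"
    by (auto intro!: inj_onI simp: Icc_eq_Icc)
  moreover have "inj_on ?f ?G" using f by (auto simp: bij_betw_def intro: inj_on_subset)
  ultimately have "inj_on (?f \<circ> ?g) ?A" by (intro comp_inj_on) (simp_all only: gA)
  moreover have "(?f \<circ> ?g) ` ?A = avoiders n - indec_avoiders n"
  proof -
    have dec: "\<not> indecomposable (?f p) \<longleftrightarrow> p \<in> ?G" if "p \<in> (SIGMA T:Pow {2..n}. avoiders_on T)" for p
      using that not_indecomposable_append_min_iff[OF assms, of "fst p" "snd p"]
      by (auto simp: case_prod_beta)
    have "avoiders n - indec_avoiders n = {\<pi> \<in> avoiders n. \<not> indecomposable \<pi>}"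
      by (auto simp: indec_avoiders_def)
    also have "\<dots> = {\<pi> \<in> ?f ` (SIGMA T:Pow {2..n}. avoiders_on T). \<not> indecomposable \<pi>}"
      using f by (simp add: bij_betw_def)
    also have "\<dots> = ?f ` {p \<in> (SIGMA T:Pow {2..n}. avoiders_on T). \<not> indecomposable (?f p)}"
      by blast
    also have "{p \<in> (SIGMA T:Pow {2..n}. avoiders_on T). \<not> indecomposable (?f p)} = ?G"
      using dec by blast
    finally show ?thesis by (simp only: image_comp[symmetric] gA)
  qed
  moreover have "?f \<circ> ?g = (\<lambda>(k, \<sigma>). glue n k \<sigma>)" by (auto simp: glue_def)
  ultimately show ?thesis by (simp only: bij_betw_def)
qed

text \<open>The tail has \<open>n - 1 - k\<close> entries, hence \<open>n - 2 - k\<close> descents,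
  and the step from 1 into it is an ascent.\<close>

lemma descents_glue:
  assumes "k < n - 1" "\<sigma> \<in> avoiders k"
  shows "descents (glue n k \<sigma>) = (if k = 0 then 0 else Suc (descents \<sigma>)) + (n - 2 - k)"
proof -
  let ?\<tau> = "rev (sorted_list_of_set ({2..n} - {2..Suc k}))"
  have S: "{2..n} - {2..Suc k} = {Suc (Suc k)..n}" by auto
  have len: "length ?\<tau> = n - 1 - k" unfolding S by simp
  then have "?\<tau> \<noteq> []" using assms(1) by (metis length_0_conv not_less zero_less_diff le_refl)
  then obtain a \<tau>' where a: "?\<tau> = a # \<tau>'" by (cases ?\<tau>) auto
  then have "a \<in> {2..n} - {2..Suc k}"
    by (metis finite_Diff finite_atLeastAtMost list.set_intros(1) set_rev set_sorted_list_of_set)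
  then have "descents (1 # ?\<tau>) = descents ?\<tau>" unfolding a by (auto simp: descents_Cons_Cons)
  also have "\<dots> = n - 2 - k" by (subst descents_decreasing) (simp_all only: len, simp_all)
  finally have d: "descents (1 # ?\<tau>) = n - 2 - k" .
  have "set \<sigma> = {1..k}" using assms by (simp add: avoiders_eq_avoiders_on avoiders_on_iff)
  then have "1 < x" if "x \<in> set (map Suc \<sigma>)" for x using that by auto
  moreover have "\<sigma> = [] \<longleftrightarrow> k = 0" using \<open>set \<sigma> = {1..k}\<close> by (metis atLeastatMost_empty_iff
     less_one not_less set_empty)
  ultimately show ?thesis unfolding glue_def by (subst descents_append_min) (use d in auto)
qed

section \<open>Generating functions\<close>

lemma finite_avoiders [simp]: "finite (avoiders n)"
  by (simp add: avoiders_eq_avoiders_on)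

lemma avoiders_0 [simp]: "avoiders 0 = {[]}"
  by (simp add: avoiders_eq_avoiders_on)

text \<open>Turns counts by descent number into a sum of weights, which bijections can
  reindex.\<close>

lemma sum_power_descents:
  fixes q :: "'a::comm_ring_1"
  assumes "n \<ge> 1" "X \<subseteq> avoiders n"
  shows "(\<Sum>i<n. of_nat (card {\<pi> \<in> X. descents \<pi> = i}) * q ^ i) = (\<Sum>\<pi>\<in>X. q ^ descents \<pi>)"
proof -
  have fin: "finite X" using assms(2) by (rule finite_subset) simp
  have "descents ` X \<subseteq> {..<n}" using assms descents_less by (auto simp: avoiders_def)
  then have "(\<Sum>\<pi>\<in>X. q ^ descents \<pi>) = (\<Sum>i<n. \<Sum>\<pi>\<in>{\<pi> \<in> X. descents \<pi> = i}. q ^ descents \<pi>)"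
    using fin by (intro sum.group[symmetric]) auto
  then show ?thesis by simp
qed

text \<open>At \<open>n = 0\<close> the explicit 1 in \<open>A_gf\<close> is the weight of the empty
  list.\<close>

lemma A_gf_nth: "fps_nth (A_gf q) n = (\<Sum>\<pi>\<in>avoiders n. q ^ descents \<pi>)"
  using sum_power_descents[of n "avoiders n" q] by (cases "n = 0") (simp_all add: A_gf_def A_num_def)

lemma I_gf_nth: "fps_nth (I_gf q) n = (\<Sum>\<pi>\<in>indec_avoiders n. q ^ descents \<pi>)"
proof (cases "n = 0")
  case True
  then have "indec_avoiders n = {}" by (auto simp: indec_avoiders_def indecomposable_def)
  with True show ?thesis by (simp add: I_gf_def)
next
  case False
  then show ?thesis using sum_power_descents[of n "indec_avoiders n" q]
    by (simp add: I_gf_def I_num_def indec_avoiders_def)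
qed

text \<open>The sum is the weight of the decomposable avoiders, transported along
  \<open>glue\<close>. The case \<open>k = 0\<close> stands apart because nothing then descends into
  the entry 1.\<close>

lemma A_gf_nth_decompose:
  fixes q :: "'a::comm_ring_1"
  assumes "n \<ge> 1"
  shows "fps_nth (A_gf q) n = fps_nth (I_gf q) n +
           (\<Sum>k<n - 1. (if k = 0 then 1 else q * fps_nth (A_gf q) k) * q ^ (n - 2 - k))"
proof -
  have "(\<Sum>\<pi>\<in>avoiders n - indec_avoiders n. q ^ descents \<pi>)
      = (\<Sum>(k, \<sigma>)\<in>(SIGMA k:{..<n - 1}. avoiders k). q ^ descents (glue n k \<sigma>))"
    using sum.reindex_bij_betw[OF bij_betw_glue[OF assms], of "\<lambda>\<pi>. q ^ descents \<pi>"]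
    by (simp only: case_prod_unfold)
  also have "\<dots> = (\<Sum>k<n - 1. \<Sum>\<sigma>\<in>avoiders k. q ^ descents (glue n k \<sigma>))"
    by (subst sum.Sigma) auto
  also have "\<dots> = (\<Sum>k<n - 1. (if k = 0 then 1 else q * fps_nth (A_gf q) k) * q ^ (n - 2 - k))"
  proof (rule sum.cong[OF refl])
    fix k assume k: "k \<in> {..<n - 1}"
    have "q ^ descents (glue n k \<sigma>) =
        (if k = 0 then 1 else q * q ^ descents \<sigma>) * q ^ (n - 2 - k)" if "\<sigma> \<in> avoiders k" for \<sigma>
      using k that by (simp only: descents_glue lessThan_iff power_add) simp
    then show "(\<Sum>\<sigma>\<in>avoiders k. q ^ descents (glue n k \<sigma>)) =
        (if k = 0 then 1 else q * fps_nth (A_gf q) k) * q ^ (n - 2 - k)"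
      by (simp add: A_gf_nth sum_distrib_left sum_distrib_right)
  qed
  finally show ?thesis
    using sum.subset_diff[of "indec_avoiders n" "avoiders n" "\<lambda>\<pi>. q ^ descents \<pi>"]
    by (simp add: A_gf_nth I_gf_nth indec_avoiders_def add.commute)
qed

text \<open>The generating function identity with the geometric series in place of a division. The
  factor \<open>fps_X ^ 2\<close> stands for the entry 1 and one entry of the nonempty tail.\<close>

lemma A_gf_eq_geometric:
  fixes q :: "'a::comm_ring_1"
  shows "A_gf q = 1 + I_gf q +
           fps_X ^ 2 * (((A_gf q - 1) * fps_const q + 1) * Abs_fps (\<lambda>k. q ^ k))"
proof (rule fps_ext)
  fix n :: nat
  let ?C = "(A_gf q - 1) * fps_const q + 1"
  let ?G = "Abs_fps (\<lambda>k. q ^ k)"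
  have C: "fps_nth ?C k = (if k = 0 then 1 else q * fps_nth (A_gf q) k)" for k
    by (auto simp: A_gf_nth mult.commute)
  \<comment> \<open>Sizes 0 and 1 admit no gluing; from size 2 on the sum is a Cauchy product of
    index \<open>n - 2\<close>.\<close>
  consider "n = 0" | "n = 1" | m where "n = m + 2" by (metis One_nat_def add_2_eq_Suc' not0_implies_Suc)
  then show "fps_nth (A_gf q) n = fps_nth (1 + I_gf q + fps_X ^ 2 * (?C * ?G)) n"
  proof cases
    case 1
    then show ?thesis by (simp add: A_gf_def I_gf_def)
  next
    case 2
    then show ?thesis using A_gf_nth_decompose[of 1 q] by (simp add: fps_X_power_mult_nth)
  next
    case 3
    have "fps_nth (fps_X ^ 2 * (?C * ?G)) n = fps_nth (?C * ?G) m"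
      by (simp add: fps_X_power_mult_nth 3)
    also have "\<dots> = (\<Sum>k<n - 1. fps_nth ?C k * q ^ (n - 2 - k))"
      unfolding fps_mult_nth 3 by (simp add: atLeast0AtMost lessThan_Suc_atMost)
    finally show ?thesis using A_gf_nth_decompose[of n q] 3 unfolding C by simp
  qed
qed

lemma geometric_fps:
  "Abs_fps (\<lambda>k. q ^ k) * (1 - fps_X * fps_const q) = (1 :: 'a::comm_ring_1 fps)" (is "?G * _ = _")
proof (rule fps_ext)
  fix n
  have "?G * (1 - fps_X * fps_const q) = ?G - fps_X * (?G * fps_const q)"
    by (simp only: right_diff_distrib mult_1_right mult.left_commute)
  then show "fps_nth (?G * (1 - fps_X * fps_const q)) n = fps_nth 1 n"
    by (cases n) (simp_all add: mult.commute)
qed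

section \<open>Specialisation at \<open>q = 1\<close> and the final formulas\<close>

lemma A_gf_one: "A_gf 1 = Bell_gf"
  by (rule fps_ext) (simp add: A_gf_nth Bell_gf_def card_avoiders)

lemma I_total_eq:
  assumes "n \<ge> 1"
  shows "int (I_total n) = int (Bell n) - (\<Sum>k<n - 1. int (Bell k))"
proof -
  \<comment> \<open>This value absorbs the exceptional term \<open>k = 0\<close>.\<close>
  have "Bell 0 = 1" using card_avoiders[of 0] by simp
  then have "(\<Sum>k<n - 1. (if k = 0 then 1 else int (Bell k))) = (\<Sum>k<n - 1. int (Bell k))"
    by (intro sum.cong) auto
  then show ?thesis
    using A_gf_nth_decompose[OF assms, of "1::int"] assms
    by (simp add: A_gf_one Bell_gf_def I_gf_1_nth cong: if_cong)
qed

theorem theorem4p2: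
  shows "(let x = (fps_X :: rat fps fps); q = (fps_X :: rat fps); Q = fps_const q in
            A_gf q = 1 + I_gf q + x / (1 - x * Q) * ((A_gf q - 1) * x * Q + x)) \<and>
         (let x = (fps_X :: rat fps) in
            I_gf 1 = (1 - x - x ^ 2) / (1 - x) * Bell_gf - 1) \<and>
         I_total 1 = 1 \<and>
         (\<forall>n\<ge>2. int (I_total n) = int (Bell n) - (\<Sum>i=0..n-2. int (Bell i)))"
proof (intro conjI)
  show "let x = (fps_X :: rat fps fps); q = (fps_X :: rat fps); Q = fps_const q in
            A_gf q = 1 + I_gf q + x / (1 - x * Q) * ((A_gf q - 1) * x * Q + x)"
    unfolding Let_def
  proof -
    let ?x = "fps_X :: rat fps fps" and ?q = "fps_X :: rat fps"
    let ?Q = "fps_const ?q" and ?G = "Abs_fps (\<lambda>k. ?q ^ k)"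
    \<comment> \<open>Multiplying by \<open>?G * (1 - ?x * ?Q) = 1\<close> lets the denominator
      cancel and leaves \<open>?G\<close>.\<close>
    have "?x / (1 - ?x * ?Q) = ?x / (1 - ?x * ?Q) * (?G * (1 - ?x * ?Q))"
      by (simp only: geometric_fps mult_1_right)
    also have "\<dots> = (?x / (1 - ?x * ?Q) * (1 - ?x * ?Q)) * ?G" by (simp only: ac_simps)
    also have "\<dots> = ?x * ?G" by (simp only: divide_one_minus_xq)
    finally have D: "?x / (1 - ?x * ?Q) = ?x * ?G" .
    have "?x ^ 2 * (((A_gf ?q - 1) * ?Q + 1) * ?G) = ?x * ?G * ((A_gf ?q - 1) * ?x * ?Q + ?x)"
      by (simp only: power2_eq_square distrib_left distrib_right mult_1_left mult_1_right ac_simps)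
    then show "A_gf ?q = 1 + I_gf ?q + ?x / (1 - ?x * ?Q) * ((A_gf ?q - 1) * ?x * ?Q + ?x)"
      unfolding D using A_gf_eq_geometric[of ?q] by (simp only:)
  qed
  show "let x = (fps_X :: rat fps) in I_gf 1 = (1 - x - x ^ 2) / (1 - x) * Bell_gf - 1"
    unfolding Let_def
  proof -
    let ?x = "fps_X :: rat fps" and ?G = "Abs_fps (\<lambda>k. 1) :: rat fps"
    have G: "?G * (1 - ?x) = 1" using geometric_fps[of "1::rat"] by simp
    have nz: "1 - ?x \<noteq> 0" using G by auto
    \<comment> \<open>Since \<open>?G * (1 - ?x) = 1\<close>, the term \<open>?x ^ 2\<close> also
      carries the factor \<open>1 - ?x\<close>.\<close>
    have "1 - ?x - ?x ^ 2 = (1 - ?x ^ 2 * ?G) * (1 - ?x)"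
      by (simp only: left_diff_distrib mult_1_left mult.assoc G mult_1_right)
    then have D: "(1 - ?x - ?x ^ 2) / (1 - ?x) = 1 - ?x ^ 2 * ?G"
      using nz by (metis nonzero_mult_div_cancel_right)
    show "I_gf 1 = (1 - ?x - ?x ^ 2) / (1 - ?x) * Bell_gf - 1"
      \<comment> \<open>At \<open>q = 1\<close> the bracket collapses to \<open>A_gf 1\<close>, and
        the identity is solved for \<open>I_gf 1\<close>.\<close>
      unfolding D using A_gf_eq_geometric[of "1::rat"] by (simp add: A_gf_one algebra_simps)
  qed
  show "I_total 1 = 1"
  proof -
    have "Bell 1 = 1" unfolding card_avoiders[symmetric]
      by (simp add: avoiders_def avoids_1_23_def permutations_of_set_singleton Collect_conv_if cong: conj_cong)
    then show ?thesis using I_total_eq[of 1] by simp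
  qed
  show "\<forall>n\<ge>2. int (I_total n) = int (Bell n) - (\<Sum>i=0..n-2. int (Bell i))"
  proof (intro allI impI)
    fix n :: nat assume n: "2 \<le> n"
    \<comment> \<open>This needs \<open>n \<ge> 2\<close>: at \<open>n = 1\<close> truncated
      subtraction would leave the index 0 on the left.\<close>
    then have "{0..n - 2} = {..<n - 1}" by auto
    then show "int (I_total n) = int (Bell n) - (\<Sum>i=0..n-2. int (Bell i))"
      using I_total_eq[of n] n by simp
  qed
qed

end
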